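(* Let $(L,T,R)$ be a quantum triad (in sup-lattices). Let $Q_1$ be the set of all pairs $(\alpha,\beta)$, where $\alpha:L\to L$ is a left $T$-module morphism and $\beta:R\to R$ is a right $T$-module morphism, such that $$\alpha(l)\,r = l\,\beta(r)\quad\text{for all } l\in L,\ r\in R,$$ ordered pointwise (joins computed pointwise). Define, for $r\in R$, $l\in L$ and $(\alpha,\beta),(\alpha',\beta')\in Q_1$, $$(\alpha,\beta)\,r=\beta(r),\qquad l\,(\alpha,\beta)=\alpha(l),$$ $$(\alpha,\beta)(\alpha',\beta')=(\alpha'\alpha,\ \beta\beta'),\qquad rl=\big(l'\mapsto (l'r)l,\ \ r'\mapsto r(lr')\big)$$ (these give, respectively, the left action $Q_1\times R\to R$, the right action $L\times Q_1\to L$, the multiplication on $Q_1$, where $\alpha'\alpha$ and $\beta\beta'$ are compositions of maps, and the map $R\times L\to Q_1$). Then $Q_1$ is a solution of $(L,T,R)$.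
   Context: A sup-lattice is a complete lattice; morphisms of sup-lattices preserve arbitrary joins. A bimorphism $S\times S'\to S''$ is a map that preserves arbitrary joins in each variable separately; its values are written as products. A quantale is a sup-lattice with an associative bimorphism $Q\times Q\to Q$ (no unit is assumed). A left $Q$-module is a sup-lattice $M$ with a bimorphism $Q\times M\to M$ satisfying $(qq')m=q(q'm)$; right modules are analogous; a $(Q,Q')$-bimodule is a left $Q$-module and right $Q'$-module with $(qm)q'=q(mq')$. A module morphism is a sup-lattice morphism commuting with the action. A (quantum) triad $(L,T,R)$ consists of a quantale $T$, a right $T$-module $R$, a left $T$-module $L$, and a bimorphism $L\times R\to T$, $(l,r)\mapsto lr$, such that $(tl)r=t(lr)$ and $(lr)t=l(rt)$ for all $l\in L$, $r\in R$, $t\in T$. A solution of the triad $(L,T,R)$ is a quantale $Q$ together with a left action $Q\times R\to R$ making $R$ a $(Q,T)$-bimodule, a right action $L\times Q\to L$ making $L$ a $(T,Q)$-bimodule, and a bimorphism $R\times L\to Q$, $(r,l)\mapsto rl$, such that for all $q\in Q$, $t\in T$, $r,r'\in R$, $l,l'\in L$: $(qr)l=q(rl)$, $(rl)q=r(lq)$, $(rt)l=r(tl)$, $(lq)r=l(qr)$, $(rl)r'=r(lr')$, $(lr)l'=l(rl')$. *)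

theory Defs
  imports "HOL-Algebra.Complete_Lattice" "HOL-Library.FuncSet"
begin

text \<open>
  Sup-lattices are the complete lattices of HOL-Algebra. Here \<open>complete_lattice\<close> is the
  carrier-based locale, not the type class of the same name. Joins of the empty family are
  included, so sup-lattice morphisms and bimorphisms preserve bottom elements.
\<close>

definition sup_hom :: "('a, 'x) gorder_scheme \<Rightarrow> ('b, 'y) gorder_scheme \<Rightarrow> ('a \<Rightarrow> 'b) \<Rightarrow> bool" where
  "sup_hom M N f \<longleftrightarrow>
     f \<in> carrier M \<rightarrow> carrier N \<and>
     (\<forall>A. A \<subseteq> carrier M \<longrightarrow> f (\<Squnion>\<^bsub>M\<^esub> A) = \<Squnion>\<^bsub>N\<^esub> (f ` A))"

definition bimorphism ::
  "('a, 'x) gorder_scheme \<Rightarrow> ('b, 'y) gorder_scheme \<Rightarrow> ('c, 'z) gorder_scheme \<Rightarrow>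
   ('a \<Rightarrow> 'b \<Rightarrow> 'c) \<Rightarrow> bool" where
  "bimorphism M N P f \<longleftrightarrow>
     (\<forall>a\<in>carrier M. sup_hom N P (\<lambda>b. f a b)) \<and>
     (\<forall>b\<in>carrier N. sup_hom M P (\<lambda>a. f a b))"

record 'a quantale = "'a gorder" +
  qmult :: "'a \<Rightarrow> 'a \<Rightarrow> 'a" (infixl \<open>\<odot>\<index>\<close> 70)

locale quantale = complete_lattice Q for Q (structure) +
  assumes mult_bimorphism: "bimorphism Q Q Q (\<odot>)"
    and mult_assoc:
      "\<lbrakk>a \<in> carrier Q; b \<in> carrier Q; c \<in> carrier Q\<rbrakk> \<Longrightarrow> (a \<odot> b) \<odot> c = a \<odot> (b \<odot> c)"

locale left_module = Q: quantale Q + M: complete_lattice M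
  for Q :: "('q, 'x) quantale_scheme" and M :: "('m, 'y) gorder_scheme" +
  fixes act :: "'q \<Rightarrow> 'm \<Rightarrow> 'm"
  assumes act_bimorphism: "bimorphism Q M M act"
    and act_assoc:
      "\<lbrakk>q \<in> carrier Q; q' \<in> carrier Q; m \<in> carrier M\<rbrakk> \<Longrightarrow> act (q \<odot>\<^bsub>Q\<^esub> q') m = act q (act q' m)"

locale right_module = Q: quantale Q + M: complete_lattice M
  for Q :: "('q, 'x) quantale_scheme" and M :: "('m, 'y) gorder_scheme" +
  fixes act :: "'m \<Rightarrow> 'q \<Rightarrow> 'm"
  assumes act_bimorphism: "bimorphism M Q M act"
    and act_assoc:
      "\<lbrakk>q \<in> carrier Q; q' \<in> carrier Q; m \<in> carrier M\<rbrakk> \<Longrightarrow> act m (q \<odot>\<^bsub>Q\<^esub> q') = act (act m q) q'"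

locale bimodule = left: left_module Q M lact + right: right_module Q' M ract
  for Q :: "('q, 'x) quantale_scheme" and Q' :: "('p, 'y) quantale_scheme"
    and M :: "('m, 'z) gorder_scheme"
    and lact :: "'q \<Rightarrow> 'm \<Rightarrow> 'm" and ract :: "'m \<Rightarrow> 'p \<Rightarrow> 'm" +
  assumes acts_commute:
    "\<lbrakk>q \<in> carrier Q; m \<in> carrier M; q' \<in> carrier Q'\<rbrakk> \<Longrightarrow> ract (lact q m) q' = lact q (ract m q')"

definition left_module_hom ::
  "('q, 'x) quantale_scheme \<Rightarrow>
   ('m, 'y) gorder_scheme \<Rightarrow> ('q \<Rightarrow> 'm \<Rightarrow> 'm) \<Rightarrow>
   ('n, 'z) gorder_scheme \<Rightarrow> ('q \<Rightarrow> 'n \<Rightarrow> 'n) \<Rightarrow> ('m \<Rightarrow> 'n) \<Rightarrow> bool" where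
  "left_module_hom Q M actM N actN f \<longleftrightarrow>
     sup_hom M N f \<and>
     (\<forall>q\<in>carrier Q. \<forall>m\<in>carrier M. f (actM q m) = actN q (f m))"

definition right_module_hom ::
  "('q, 'x) quantale_scheme \<Rightarrow>
   ('m, 'y) gorder_scheme \<Rightarrow> ('m \<Rightarrow> 'q \<Rightarrow> 'm) \<Rightarrow>
   ('n, 'z) gorder_scheme \<Rightarrow> ('n \<Rightarrow> 'q \<Rightarrow> 'n) \<Rightarrow> ('m \<Rightarrow> 'n) \<Rightarrow> bool" where
  "right_module_hom Q M actM N actN f \<longleftrightarrow>
     sup_hom M N f \<and>
     (\<forall>q\<in>carrier Q. \<forall>m\<in>carrier M. f (actM m q) = actN (f m) q)"

locale triad = L: left_module T L act_TL + R: right_module T R act_RT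
  for L :: "('l, 'x) gorder_scheme" and T :: "('t, 'y) quantale_scheme"
    and R :: "('r, 'z) gorder_scheme"
    and act_TL :: "'t \<Rightarrow> 'l \<Rightarrow> 'l" and act_RT :: "'r \<Rightarrow> 't \<Rightarrow> 'r" +
  fixes pair_LR :: "'l \<Rightarrow> 'r \<Rightarrow> 't"
  assumes pairing_bimorphism: "bimorphism L R T pair_LR"
    and pairing_left:
      "\<lbrakk>t \<in> carrier T; l \<in> carrier L; r \<in> carrier R\<rbrakk> \<Longrightarrow> pair_LR (act_TL t l) r = t \<odot>\<^bsub>T\<^esub> pair_LR l r"
    and pairing_right:
      "\<lbrakk>t \<in> carrier T; l \<in> carrier L; r \<in> carrier R\<rbrakk> \<Longrightarrow> pair_LR l r \<odot>\<^bsub>T\<^esub> t = pair_LR l (act_RT r t)"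

locale solution =
  triad L T R act_TL act_RT pair_LR +
  R: bimodule Q T R act_QR act_RT +
  L: bimodule T Q L act_TL act_LQ
  for L :: "('l, 'x) gorder_scheme" and T :: "('t, 'y) quantale_scheme"
    and R :: "('r, 'z) gorder_scheme"
    and act_TL :: "'t \<Rightarrow> 'l \<Rightarrow> 'l" and act_RT :: "'r \<Rightarrow> 't \<Rightarrow> 'r" and pair_LR :: "'l \<Rightarrow> 'r \<Rightarrow> 't"
    and Q :: "('q, 'w) quantale_scheme"
    and act_QR :: "'q \<Rightarrow> 'r \<Rightarrow> 'r" and act_LQ :: "'l \<Rightarrow> 'q \<Rightarrow> 'l" +
  fixes pair_RL :: "'r \<Rightarrow> 'l \<Rightarrow> 'q"
  assumes rl_bimorphism: "bimorphism R L Q pair_RL"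
    and qr_l: "\<lbrakk>q \<in> carrier Q; r \<in> carrier R; l \<in> carrier L\<rbrakk> \<Longrightarrow> pair_RL (act_QR q r) l = q \<odot>\<^bsub>Q\<^esub> pair_RL r l"
    and rl_q: "\<lbrakk>r \<in> carrier R; l \<in> carrier L; q \<in> carrier Q\<rbrakk> \<Longrightarrow> pair_RL r l \<odot>\<^bsub>Q\<^esub> q = pair_RL r (act_LQ l q)"
    and rt_l: "\<lbrakk>r \<in> carrier R; t \<in> carrier T; l \<in> carrier L\<rbrakk> \<Longrightarrow> pair_RL (act_RT r t) l = pair_RL r (act_TL t l)"
    and lq_r: "\<lbrakk>l \<in> carrier L; q \<in> carrier Q; r \<in> carrier R\<rbrakk> \<Longrightarrow> pair_LR (act_LQ l q) r = pair_LR l (act_QR q r)"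
    and rl_r: "\<lbrakk>r \<in> carrier R; l \<in> carrier L; r' \<in> carrier R\<rbrakk> \<Longrightarrow> act_QR (pair_RL r l) r' = act_RT r (pair_LR l r')"
    and lr_l: "\<lbrakk>l \<in> carrier L; r \<in> carrier R; l' \<in> carrier L\<rbrakk> \<Longrightarrow> act_TL (pair_LR l r) l' = act_LQ l (pair_RL r l')"

text \<open>
  Maps out of a carrier are represented by functions that are \<open>undefined\<close> outside it, so that
  equality of pairs is equality of maps. Accordingly \<open>compose\<close> and \<open>restrict\<close> below keep the
  results in this normal form.
\<close>

definition Q1 ::
  "('l, 'x) gorder_scheme \<Rightarrow> ('t, 'y) quantale_scheme \<Rightarrow> ('r, 'z) gorder_scheme \<Rightarrow>
   ('t \<Rightarrow> 'l \<Rightarrow> 'l) \<Rightarrow> ('r \<Rightarrow> 't \<Rightarrow> 'r) \<Rightarrow> ('l \<Rightarrow> 'r \<Rightarrow> 't) \<Rightarrow>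
   (('l \<Rightarrow> 'l) \<times> ('r \<Rightarrow> 'r)) quantale" where
  "Q1 L T R act_TL act_RT pair_LR =
     \<lparr>carrier = {(\<alpha>, \<beta>).
          left_module_hom T L act_TL L act_TL \<alpha> \<and> \<alpha> \<in> extensional (carrier L) \<and>
          right_module_hom T R act_RT R act_RT \<beta> \<and> \<beta> \<in> extensional (carrier R) \<and>
          (\<forall>l\<in>carrier L. \<forall>r\<in>carrier R. pair_LR (\<alpha> l) r = pair_LR l (\<beta> r))},
      eq = (=),
      le = (\<lambda>(\<alpha>, \<beta>) (\<alpha>', \<beta>').
          (\<forall>l\<in>carrier L. \<alpha> l \<sqsubseteq>\<^bsub>L\<^esub> \<alpha>' l) \<and> (\<forall>r\<in>carrier R. \<beta> r \<sqsubseteq>\<^bsub>R\<^esub> \<beta>' r)),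
      qmult = (\<lambda>(\<alpha>, \<beta>) (\<alpha>', \<beta>').
          (compose (carrier L) \<alpha>' \<alpha>, compose (carrier R) \<beta> \<beta>'))\<rparr>"

definition Q1_left_act :: "('l \<Rightarrow> 'l) \<times> ('r \<Rightarrow> 'r) \<Rightarrow> 'r \<Rightarrow> 'r" where
  "Q1_left_act = (\<lambda>(\<alpha>, \<beta>) r. \<beta> r)"

definition Q1_right_act :: "'l \<Rightarrow> ('l \<Rightarrow> 'l) \<times> ('r \<Rightarrow> 'r) \<Rightarrow> 'l" where
  "Q1_right_act = (\<lambda>l (\<alpha>, \<beta>). \<alpha> l)"

definition Q1_pairing ::
  "('l, 'x) gorder_scheme \<Rightarrow> ('r, 'z) gorder_scheme \<Rightarrow>
   ('t \<Rightarrow> 'l \<Rightarrow> 'l) \<Rightarrow> ('r \<Rightarrow> 't \<Rightarrow> 'r) \<Rightarrow> ('l \<Rightarrow> 'r \<Rightarrow> 't) \<Rightarrow>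
   'r \<Rightarrow> 'l \<Rightarrow> ('l \<Rightarrow> 'l) \<times> ('r \<Rightarrow> 'r)" where
  "Q1_pairing L R act_TL act_RT pair_LR r l =
     (\<lambda>l'\<in>carrier L. act_TL (pair_LR l' r) l, \<lambda>r'\<in>carrier R. act_RT r (pair_LR l r'))"

end

theory Submission
  imports Defs
begin

text \<open>
  In both components of \<open>Q1\<close> joins are computed pointwise: the pointwise join of module morphisms
  is a module morphism because joins commute with each other and with the actions, and the
  compatibility condition survives because the pairing preserves joins in each variable. Hence a
  map into \<open>Q1\<close> is a sup-lattice morphism as soon as all its evaluations are, which reduces
  each bimorphism axiom of a solution to compositions of the given bimorphisms.
\<close>

section \<open>Least upper bounds and iterated joins\<close>

lemma (in complete_lattice) sup_eqI:
  assumes "A \<subseteq> carrier L" "x \<in> carrier L"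
    and "\<And>a. a \<in> A \<Longrightarrow> a \<sqsubseteq> x"
    and "\<And>y. \<lbrakk>y \<in> carrier L; \<And>a. a \<in> A \<Longrightarrow> a \<sqsubseteq> y\<rbrakk> \<Longrightarrow> x \<sqsubseteq> y"
  shows "\<Squnion>A = x"
proof (rule le_antisym)
  show "\<Squnion>A \<sqsubseteq> x"
    by (rule sup_least) (use assms in auto)
  show "x \<sqsubseteq> \<Squnion>A"
    by (rule assms(4)) (use assms(1) sup_upper in auto)
qed (use assms in auto)

text \<open>Both sides are least upper bounds of the same doubly indexed family. It suffices that
  the right side is the least upper bound of the row joins: each entry \<open>f i j\<close> lies
  below its column join, and any bound of the row joins bounds every entry and hence every column
  join.\<close>

lemma (in complete_lattice) sup_swap:
  assumes f: "\<And>i j. \<lbrakk>i \<in> I; j \<in> J\<rbrakk> \<Longrightarrow> f i j \<in> carrier L"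
  shows "\<Squnion>((\<lambda>i. \<Squnion>(f i ` J)) ` I) = \<Squnion>((\<lambda>j. \<Squnion>((\<lambda>i. f i j) ` I)) ` J)"
proof (rule sup_eqI)
  have row: "\<Squnion>(f i ` J) \<in> carrier L" if "i \<in> I" for i
    using f that by (intro sup_closed) auto
  have col: "\<Squnion>((\<lambda>i. f i j) ` I) \<in> carrier L" if "j \<in> J" for j
    using f that by (intro sup_closed) auto
  show "(\<lambda>i. \<Squnion>(f i ` J)) ` I \<subseteq> carrier L"
    using row by auto
  show cols: "\<Squnion>((\<lambda>j. \<Squnion>((\<lambda>i. f i j) ` I)) ` J) \<in> carrier L"
    using col by (intro sup_closed) auto
  show "a \<sqsubseteq> \<Squnion>((\<lambda>j. \<Squnion>((\<lambda>i. f i j) ` I)) ` J)" if "a \<in> (\<lambda>i. \<Squnion>(f i ` J)) ` I" for a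
  proof -
    from that obtain i where i: "i \<in> I" and a: "a = \<Squnion>(f i ` J)" by auto
    show ?thesis
      unfolding a
    proof (rule sup_least)
      fix x assume "x \<in> f i ` J"
      then obtain j where j: "j \<in> J" and x: "x = f i j" by auto
      have "x \<sqsubseteq> \<Squnion>((\<lambda>i. f i j) ` I)"
        unfolding x by (rule sup_upper) (use f i j in auto)
      also have "\<dots> \<sqsubseteq> \<Squnion>((\<lambda>j. \<Squnion>((\<lambda>i. f i j) ` I)) ` J)"
        by (rule sup_upper) (use col j in auto)
      finally show "x \<sqsubseteq> \<Squnion>((\<lambda>j. \<Squnion>((\<lambda>i. f i j) ` I)) ` J)"
        using f i j x col cols by auto
    qed (use f i cols in auto)
  qed
  show "\<Squnion>((\<lambda>j. \<Squnion>((\<lambda>i. f i j) ` I)) ` J) \<sqsubseteq> y"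
    if y: "y \<in> carrier L" and ub: "\<And>a. a \<in> (\<lambda>i. \<Squnion>(f i ` J)) ` I \<Longrightarrow> a \<sqsubseteq> y" for y
  proof (rule sup_least)
    fix x assume "x \<in> (\<lambda>j. \<Squnion>((\<lambda>i. f i j) ` I)) ` J"
    then obtain j where j: "j \<in> J" and x: "x = \<Squnion>((\<lambda>i. f i j) ` I)" by auto
    have entry: "f i j \<sqsubseteq> y" if i: "i \<in> I" for i
    proof -
      have "f i j \<sqsubseteq> \<Squnion>(f i ` J)"
        by (rule sup_upper) (use f i j in auto)
      also have "\<dots> \<sqsubseteq> y"
        using ub i by auto
      finally show ?thesis
        using f i j row y by auto
    qed
    show "x \<sqsubseteq> y"
      unfolding x by (rule sup_least) (use f j y entry in auto)
  qed (use col y in auto)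
qed

section \<open>Sup-lattice morphisms and bimorphisms\<close>

lemma sup_homD:
  assumes "sup_hom M N f"
  shows sup_hom_closed: "x \<in> carrier M \<Longrightarrow> f x \<in> carrier N"
    and sup_hom_sup: "A \<subseteq> carrier M \<Longrightarrow> f (\<Squnion>\<^bsub>M\<^esub> A) = \<Squnion>\<^bsub>N\<^esub> (f ` A)"
  using assms by (auto simp: sup_hom_def)

lemma sup_hom_comp:
  assumes f: "sup_hom M N f" and g: "sup_hom N P g"
  shows "sup_hom M P (\<lambda>x. g (f x))"
  unfolding sup_hom_def
proof (intro conjI allI impI)
  show "(\<lambda>x. g (f x)) \<in> carrier M \<rightarrow> carrier P"
    using f g by (auto simp: sup_hom_def)
  fix A assume A: "A \<subseteq> carrier M"
  then have "f ` A \<subseteq> carrier N"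
    using f by (auto simp: sup_hom_def)
  with A show "g (f (\<Squnion>\<^bsub>M\<^esub> A)) = \<Squnion>\<^bsub>P\<^esub> ((\<lambda>x. g (f x)) ` A)"
    by (simp add: sup_hom_sup[OF f] sup_hom_sup[OF g] image_image)
qed

text \<open>Transfers the morphism property to functions cut off outside the carrier by
  \<open>restrict\<close> or \<open>compose\<close>. Completeness of \<open>M\<close> keeps the join
  of \<open>A\<close> in the carrier, where \<open>g\<close> and \<open>f\<close> agree.\<close>

lemma sup_hom_cong:
  assumes "complete_lattice M" and f: "sup_hom M N f"
    and eq: "\<And>x. x \<in> carrier M \<Longrightarrow> g x = f x"
  shows "sup_hom M N g"
  unfolding sup_hom_def
proof (intro conjI allI impI)
  interpret M: complete_lattice M by fact
  show "g \<in> carrier M \<rightarrow> carrier N"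
    using sup_hom_closed[OF f] eq by auto
  fix A assume A: "A \<subseteq> carrier M"
  then have "g ` A = f ` A"
    using eq by (intro image_cong) auto
  with A show "g (\<Squnion>\<^bsub>M\<^esub> A) = \<Squnion>\<^bsub>N\<^esub> (g ` A)"
    using eq[OF M.sup_closed[OF A]] sup_hom_sup[OF f A] by simp
qed

text \<open>Once each \<open>f i\<close> is moved inside the join over \<open>A\<close>, what
  remains is the interchange of two joins.\<close>

lemma sup_hom_pointwise_sup:
  assumes "complete_lattice N" and f: "\<And>i. i \<in> I \<Longrightarrow> sup_hom M N (f i)"
  shows "sup_hom M N (\<lambda>x. \<Squnion>\<^bsub>N\<^esub> ((\<lambda>i. f i x) ` I))"
  unfolding sup_hom_def
proof (intro conjI allI impI)
  interpret N: complete_lattice N by fact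
  show "(\<lambda>x. \<Squnion>\<^bsub>N\<^esub> ((\<lambda>i. f i x) ` I)) \<in> carrier M \<rightarrow> carrier N"
    using sup_hom_closed[OF f] by (auto intro!: N.sup_closed)
  fix A assume A: "A \<subseteq> carrier M"
  then have "(\<lambda>i. f i (\<Squnion>\<^bsub>M\<^esub> A)) ` I = (\<lambda>i. \<Squnion>\<^bsub>N\<^esub> (f i ` A)) ` I"
    using sup_hom_sup[OF f] by (intro image_cong) auto
  then show "\<Squnion>\<^bsub>N\<^esub> ((\<lambda>i. f i (\<Squnion>\<^bsub>M\<^esub> A)) ` I) = \<Squnion>\<^bsub>N\<^esub> ((\<lambda>x. \<Squnion>\<^bsub>N\<^esub> ((\<lambda>i. f i x) ` I)) ` A)"
    using N.sup_swap[of I A f] sup_hom_closed[OF f] subsetD[OF A] by simp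
qed

lemma bimorphismD:
  assumes "bimorphism M N P f"
  shows bimorphism_left: "b \<in> carrier N \<Longrightarrow> sup_hom M P (\<lambda>a. f a b)"
    and bimorphism_right: "a \<in> carrier M \<Longrightarrow> sup_hom N P (f a)"
    and bimorphism_closed: "\<lbrakk>a \<in> carrier M; b \<in> carrier N\<rbrakk> \<Longrightarrow> f a b \<in> carrier P"
  using assms by (auto simp: bimorphism_def sup_hom_def)

section \<open>Elements, order and product of \<open>Q1\<close>\<close>

context triad
begin

abbreviation Q :: "(('l \<Rightarrow> 'l) \<times> ('r \<Rightarrow> 'r)) quantale" where
  "Q \<equiv> Q1 L T R act_TL act_RT pair_LR"

abbreviation pair_RL :: "'r \<Rightarrow> 'l \<Rightarrow> ('l \<Rightarrow> 'l) \<times> ('r \<Rightarrow> 'r)" where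
  "pair_RL \<equiv> Q1_pairing L R act_TL act_RT pair_LR"

text \<open>The candidate for the join in \<open>Q1\<close>, restricted so that both components are
  extensional. For empty \<open>A\<close> both are constantly bottom on their carriers.\<close>

definition Q1_join :: "(('l \<Rightarrow> 'l) \<times> ('r \<Rightarrow> 'r)) set \<Rightarrow> ('l \<Rightarrow> 'l) \<times> ('r \<Rightarrow> 'r)" where
  "Q1_join A = (\<lambda>l\<in>carrier L. \<Squnion>\<^bsub>L\<^esub> ((\<lambda>p. fst p l) ` A), \<lambda>r\<in>carrier R. \<Squnion>\<^bsub>R\<^esub> ((\<lambda>p. snd p r) ` A))"

lemmas TL = L.act_bimorphism
lemmas RT = R.act_bimorphism
lemmas LR = pairing_bimorphism
lemmas triad_closed = bimorphism_closed[OF TL] bimorphism_closed[OF RT] bimorphism_closed[OF LR]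

lemma Q1_carrierI:
  assumes "sup_hom L L (fst p)" "sup_hom R R (snd p)"
    and "fst p \<in> extensional (carrier L)" "snd p \<in> extensional (carrier R)"
    and "\<And>t l. \<lbrakk>t \<in> carrier T; l \<in> carrier L\<rbrakk> \<Longrightarrow> fst p (act_TL t l) = act_TL t (fst p l)"
    and "\<And>t r. \<lbrakk>t \<in> carrier T; r \<in> carrier R\<rbrakk> \<Longrightarrow> snd p (act_RT r t) = act_RT (snd p r) t"
    and "\<And>l r. \<lbrakk>l \<in> carrier L; r \<in> carrier R\<rbrakk> \<Longrightarrow> pair_LR (fst p l) r = pair_LR l (snd p r)"
  shows "p \<in> carrier Q"
  using assms by (auto simp: Q1_def left_module_hom_def right_module_hom_def split: prod.splits)

lemma Q1_carrierD:
  assumes "p \<in> carrier Q"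
  shows Q1_fst_hom: "sup_hom L L (fst p)"
    and Q1_snd_hom: "sup_hom R R (snd p)"
    and Q1_fst_ext: "fst p \<in> extensional (carrier L)"
    and Q1_snd_ext: "snd p \<in> extensional (carrier R)"
    and Q1_fst_act: "\<lbrakk>t \<in> carrier T; l \<in> carrier L\<rbrakk> \<Longrightarrow> fst p (act_TL t l) = act_TL t (fst p l)"
    and Q1_snd_act: "\<lbrakk>t \<in> carrier T; r \<in> carrier R\<rbrakk> \<Longrightarrow> snd p (act_RT r t) = act_RT (snd p r) t"
    and Q1_compat: "\<lbrakk>l \<in> carrier L; r \<in> carrier R\<rbrakk> \<Longrightarrow> pair_LR (fst p l) r = pair_LR l (snd p r)"
    and Q1_fst_closed: "l \<in> carrier L \<Longrightarrow> fst p l \<in> carrier L"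
    and Q1_snd_closed: "r \<in> carrier R \<Longrightarrow> snd p r \<in> carrier R"
  using assms by (auto simp: Q1_def left_module_hom_def right_module_hom_def sup_hom_def)

text \<open>Agreement on the carriers is enough because the components are extensional. Antisymmetry
  of the pointwise order rests on this.\<close>

lemma Q1_eqI:
  assumes "p \<in> carrier Q" "q \<in> carrier Q"
    and "\<And>l. l \<in> carrier L \<Longrightarrow> fst p l = fst q l"
    and "\<And>r. r \<in> carrier R \<Longrightarrow> snd p r = snd q r"
  shows "p = q"
  using assms by (intro prod_eqI) (blast intro: extensionalityI Q1_fst_ext Q1_snd_ext)+

lemma Q1_le:
  "p \<sqsubseteq>\<^bsub>Q\<^esub> q \<longleftrightarrow>
     (\<forall>l\<in>carrier L. fst p l \<sqsubseteq>\<^bsub>L\<^esub> fst q l) \<and> (\<forall>r\<in>carrier R. snd p r \<sqsubseteq>\<^bsub>R\<^esub> snd q r)"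
  by (simp add: Q1_def case_prod_beta)

lemma Q1_eq: "p .=\<^bsub>Q\<^esub> q \<longleftrightarrow> p = q"
  by (simp add: Q1_def)

lemma Q1_mult:
  "p \<odot>\<^bsub>Q\<^esub> q = (compose (carrier L) (fst q) (fst p), compose (carrier R) (snd p) (snd q))"
  by (simp add: Q1_def case_prod_beta)

section \<open>Completeness of \<open>Q1\<close>\<close>

lemma Q1_join_closed:
  assumes A: "A \<subseteq> carrier Q"
  shows "Q1_join A \<in> carrier Q"
proof -
  note mem = subsetD[OF A]
  have fst_A: "(\<lambda>p. fst p l) ` A \<subseteq> carrier L" if "l \<in> carrier L" for l
    using that Q1_fst_closed[OF mem] by auto
  have snd_A: "(\<lambda>p. snd p r) ` A \<subseteq> carrier R" if "r \<in> carrier R" for r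
    using that Q1_snd_closed[OF mem] by auto
  show ?thesis
  proof (rule Q1_carrierI)
    have "sup_hom L L (\<lambda>l. \<Squnion>\<^bsub>L\<^esub> ((\<lambda>p. fst p l) ` A))"
      by (rule sup_hom_pointwise_sup) (use Q1_fst_hom[OF mem] in \<open>auto intro: L.M.complete_lattice_axioms\<close>)
    then show "sup_hom L L (fst (Q1_join A))"
      by (rule sup_hom_cong[OF L.M.complete_lattice_axioms]) (simp add: Q1_join_def)
    have "sup_hom R R (\<lambda>r. \<Squnion>\<^bsub>R\<^esub> ((\<lambda>p. snd p r) ` A))"
      by (rule sup_hom_pointwise_sup) (use Q1_snd_hom[OF mem] in \<open>auto intro: R.M.complete_lattice_axioms\<close>)
    then show "sup_hom R R (snd (Q1_join A))"
      by (rule sup_hom_cong[OF R.M.complete_lattice_axioms]) (simp add: Q1_join_def)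
  next
    fix t l assume tl: "t \<in> carrier T" "l \<in> carrier L"
    have "(\<lambda>p. fst p (act_TL t l)) ` A = (\<lambda>p. act_TL t (fst p l)) ` A"
      using tl Q1_fst_act[OF mem] by (intro image_cong) auto
    \<comment> \<open>Acting by a fixed \<open>t\<close> preserves joins in \<open>L\<close>, so it
      can be pulled out of the pointwise join.\<close>
    then show "fst (Q1_join A) (act_TL t l) = act_TL t (fst (Q1_join A) l)"
      using tl by (simp add: Q1_join_def triad_closed fst_A
          sup_hom_sup[OF bimorphism_right[OF TL]] image_image)
  next
    fix t r assume tr: "t \<in> carrier T" "r \<in> carrier R"
    have "(\<lambda>p. snd p (act_RT r t)) ` A = (\<lambda>p. act_RT (snd p r) t) ` A"
      using tr Q1_snd_act[OF mem] by (intro image_cong) auto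
    then show "snd (Q1_join A) (act_RT r t) = act_RT (snd (Q1_join A) r) t"
      using tr by (simp add: Q1_join_def triad_closed snd_A
          sup_hom_sup[OF bimorphism_left[OF RT]] image_image)
  next
    fix l r assume lr: "l \<in> carrier L" "r \<in> carrier R"
    have "(\<lambda>p. pair_LR (fst p l) r) ` A = (\<lambda>p. pair_LR l (snd p r)) ` A"
      using lr Q1_compat[OF mem] by (intro image_cong) auto
    \<comment> \<open>The left side uses join preservation of the pairing in its first variable, the
      right side in its second; the two resulting joins in \<open>T\<close> range over the same
      set.\<close>
    then show "pair_LR (fst (Q1_join A) l) r = pair_LR l (snd (Q1_join A) r)"
      using lr by (simp add: Q1_join_def fst_A snd_A sup_hom_sup[OF bimorphism_left[OF LR]]
          sup_hom_sup[OF bimorphism_right[OF LR]] image_image)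
  qed (auto simp: Q1_join_def)
qed

lemma Q1_join_upper:
  assumes A: "A \<subseteq> carrier Q" and p: "p \<in> A"
  shows "p \<sqsubseteq>\<^bsub>Q\<^esub> Q1_join A"
  unfolding Q1_le Q1_join_def
  using p Q1_fst_closed[OF subsetD[OF A]] Q1_snd_closed[OF subsetD[OF A]]
  by (auto intro!: L.M.sup_upper R.M.sup_upper)

lemma Q1_join_least:
  assumes A: "A \<subseteq> carrier Q" and q: "q \<in> carrier Q" and ub: "\<And>p. p \<in> A \<Longrightarrow> p \<sqsubseteq>\<^bsub>Q\<^esub> q"
  shows "Q1_join A \<sqsubseteq>\<^bsub>Q\<^esub> q"
  unfolding Q1_le Q1_join_def
  using ub Q1_fst_closed[OF subsetD[OF A]] Q1_snd_closed[OF subsetD[OF A]]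
    Q1_fst_closed[OF q] Q1_snd_closed[OF q]
  by (auto simp: Q1_le intro!: L.M.sup_least R.M.sup_least)

sublocale Q: complete_lattice Q
proof -
  interpret partial_order Q
  proof
    fix p q assume pq: "p \<in> carrier Q" "q \<in> carrier Q"
    show "p .=\<^bsub>Q\<^esub> q" if "p \<sqsubseteq>\<^bsub>Q\<^esub> q" "q \<sqsubseteq>\<^bsub>Q\<^esub> p"
      unfolding Q1_eq using that Q1_fst_closed[OF pq(1)] Q1_fst_closed[OF pq(2)]
        Q1_snd_closed[OF pq(1)] Q1_snd_closed[OF pq(2)]
      by (intro Q1_eqI pq) (simp_all add: Q1_le L.M.le_antisym R.M.le_antisym)
  next
    fix p q s assume "p \<sqsubseteq>\<^bsub>Q\<^esub> q" "q \<sqsubseteq>\<^bsub>Q\<^esub> s" "p \<in> carrier Q" "q \<in> carrier Q" "s \<in> carrier Q"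
    then show "p \<sqsubseteq>\<^bsub>Q\<^esub> s"
      unfolding Q1_le by (meson L.M.le_trans R.M.le_trans Q1_fst_closed Q1_snd_closed)
  qed (auto simp: Q1_eq Q1_le Q1_fst_closed Q1_snd_closed fun_eq_iff)
  show "complete_lattice Q"
  proof (rule complete_latticeI)
    fix A assume A: "A \<subseteq> carrier Q"
    have "least Q (Q1_join A) (Upper Q A)"
    proof (rule least_UpperI)
      show "Q1_join A \<sqsubseteq>\<^bsub>Q\<^esub> q" if q: "q \<in> Upper Q A" for q
        using Upper_memD[OF q _ A] subsetD[OF Upper_closed q] by (intro Q1_join_least[OF A]) auto
    qed (use A Q1_join_closed Q1_join_upper in blast)+
    then show "\<exists>s. least Q s (Upper Q A)" ..
    \<comment> \<open>The infimum of \<open>A\<close> is obtained as the join of all its lower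
      bounds. A pointwise meet would not serve directly, since morphisms preserve joins but not
      meets in general.\<close>
    have B: "Lower Q A \<subseteq> carrier Q"
      by simp
    show "\<exists>i. greatest Q i (Lower Q A)"
      by (rule exI[of _ "Q1_join (Lower Q A)"], rule greatest_LowerI)
        (use A Q1_join_closed[OF B] Q1_join_upper[OF B] Q1_join_least[OF B] in
          \<open>auto simp: Lower_def\<close>)
  qed
qed

text \<open>\<open>Q1\<close> is given by its order alone, so its join is known only as a least
  upper bound; uniqueness of least upper bounds identifies it with the explicit formula.\<close>

lemma Q1_sup:
  assumes "A \<subseteq> carrier Q"
  shows "\<Squnion>\<^bsub>Q\<^esub> A = Q1_join A"
  using assms by (intro Q.sup_eqI Q1_join_closed Q1_join_upper Q1_join_least) auto

section \<open>Evaluation maps and morphisms into \<open>Q1\<close>\<close>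

lemma sup_hom_Q1_fst: "l \<in> carrier L \<Longrightarrow> sup_hom Q L (\<lambda>p. fst p l)"
  by (auto simp: sup_hom_def Q1_sup Q1_join_def Q1_fst_closed)

lemma sup_hom_Q1_snd: "r \<in> carrier R \<Longrightarrow> sup_hom Q R (\<lambda>p. snd p r)"
  by (auto simp: sup_hom_def Q1_sup Q1_join_def Q1_snd_closed)

lemma sup_hom_Q1I:
  assumes "complete_lattice M"
    and f: "\<And>x. x \<in> carrier M \<Longrightarrow> f x \<in> carrier Q"
    and fst_f: "\<And>l. l \<in> carrier L \<Longrightarrow> sup_hom M L (\<lambda>x. fst (f x) l)"
    and snd_f: "\<And>r. r \<in> carrier R \<Longrightarrow> sup_hom M R (\<lambda>x. snd (f x) r)"
  shows "sup_hom M Q f"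
  unfolding sup_hom_def
proof (intro conjI allI impI)
  interpret M: complete_lattice M by fact
  show "f \<in> carrier M \<rightarrow> carrier Q"
    using f by auto
  fix A assume A: "A \<subseteq> carrier M"
  then have fA: "f ` A \<subseteq> carrier Q"
    using f by auto
  show "f (\<Squnion>\<^bsub>M\<^esub> A) = \<Squnion>\<^bsub>Q\<^esub> (f ` A)"
    unfolding Q1_sup[OF fA]
    by (intro Q1_eqI Q1_join_closed)
      (use A f fA in \<open>auto simp: Q1_join_def image_image sup_hom_sup[OF fst_f] sup_hom_sup[OF snd_f]\<close>)
qed

section \<open>Closure under product and pairing, and the quantale structure\<close>

lemma Q1_mult_closed:
  assumes p: "p \<in> carrier Q" and q: "q \<in> carrier Q"
  shows "p \<odot>\<^bsub>Q\<^esub> q \<in> carrier Q"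
proof (rule Q1_carrierI)
  show "sup_hom L L (fst (p \<odot>\<^bsub>Q\<^esub> q))"
    by (rule sup_hom_cong[OF L.M.complete_lattice_axioms
          sup_hom_comp[OF Q1_fst_hom[OF p] Q1_fst_hom[OF q]]])
      (simp add: Q1_mult compose_eq)
  show "sup_hom R R (snd (p \<odot>\<^bsub>Q\<^esub> q))"
    by (rule sup_hom_cong[OF R.M.complete_lattice_axioms
          sup_hom_comp[OF Q1_snd_hom[OF q] Q1_snd_hom[OF p]]])
      (simp add: Q1_mult compose_eq)
\<comment> \<open>Compatibility depends on the reversed order in the first component: writing
  \<open>p\<close> as (\<alpha>, \<beta>) and \<open>q\<close> as (\<alpha>', \<beta>'),
  \<alpha>'(\<alpha>(l)) r = \<alpha>(l) \<beta>'(r) = l \<beta>(\<beta>'(r)).\<close>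
qed (use p q in \<open>simp_all add: Q1_mult compose_eq triad_closed Q1_carrierD\<close>)

lemma Q1_pairing_closed:
  assumes r: "r \<in> carrier R" and l: "l \<in> carrier L"
  shows "pair_RL r l \<in> carrier Q"
proof (rule Q1_carrierI)
  show "sup_hom L L (fst (pair_RL r l))"
    by (rule sup_hom_cong[OF L.M.complete_lattice_axioms
          sup_hom_comp[OF bimorphism_left[OF LR r] bimorphism_left[OF TL l]]])
      (simp add: Q1_pairing_def)
  show "sup_hom R R (snd (pair_RL r l))"
    by (rule sup_hom_cong[OF R.M.complete_lattice_axioms
          sup_hom_comp[OF bimorphism_right[OF LR l] bimorphism_right[OF RT r]]])
      (simp add: Q1_pairing_def)
\<comment> \<open>With \<open>pairing_right\<close> reversed, both sides of compatibility become one
  product in \<open>T\<close>: ((l'r)l)r' = (l'r)(lr') = l'(r(lr')). The two module morphism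
  conditions follow from associativity of the actions.\<close>
qed (use r l in \<open>simp_all add: Q1_pairing_def triad_closed pairing_left
      L.act_assoc R.act_assoc flip: pairing_right\<close>)

lemma Q1_left_act_eq: "Q1_left_act p r = snd p r"
  by (simp add: Q1_left_act_def case_prod_beta)

lemma Q1_right_act_eq: "Q1_right_act l p = fst p l"
  by (simp add: Q1_right_act_def case_prod_beta)

lemma quantale_Q1: "quantale Q"
proof unfold_locales
  show "bimorphism Q Q Q (\<odot>\<^bsub>Q\<^esub>)"
    unfolding bimorphism_def
  proof (intro conjI ballI sup_hom_Q1I Q1_mult_closed Q.complete_lattice_axioms)
    fix p l assume p: "p \<in> carrier Q" and l: "l \<in> carrier L"
    \<comment> \<open>With the left factor \<open>p\<close> fixed, this is evaluation at
      \<open>fst p l\<close>; with the right factor fixed, it is evaluation at \<open>l\<close>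
      followed by the morphism \<open>fst p\<close>. In the second component the two roles are
      exchanged.\<close>
    show "sup_hom Q L (\<lambda>q. fst (p \<odot>\<^bsub>Q\<^esub> q) l)"
      using sup_hom_Q1_fst[OF Q1_fst_closed[OF p l]] l by (simp add: Q1_mult compose_eq)
    show "sup_hom Q L (\<lambda>q. fst (q \<odot>\<^bsub>Q\<^esub> p) l)"
      using sup_hom_comp[OF sup_hom_Q1_fst[OF l] Q1_fst_hom[OF p]] l
      by (simp add: Q1_mult compose_eq)
  next
    fix p r assume p: "p \<in> carrier Q" and r: "r \<in> carrier R"
    show "sup_hom Q R (\<lambda>q. snd (p \<odot>\<^bsub>Q\<^esub> q) r)"
      using sup_hom_comp[OF sup_hom_Q1_snd[OF r] Q1_snd_hom[OF p]] r
      by (simp add: Q1_mult compose_eq)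
    show "sup_hom Q R (\<lambda>q. snd (q \<odot>\<^bsub>Q\<^esub> p) r)"
      using sup_hom_Q1_snd[OF Q1_snd_closed[OF p r]] r by (simp add: Q1_mult compose_eq)
  qed
next
  fix p q s assume "p \<in> carrier Q" "q \<in> carrier Q" "s \<in> carrier Q"
  then show "(p \<odot>\<^bsub>Q\<^esub> q) \<odot>\<^bsub>Q\<^esub> s = p \<odot>\<^bsub>Q\<^esub> (q \<odot>\<^bsub>Q\<^esub> s)"
    by (intro Q1_eqI Q1_mult_closed)
      (auto simp: Q1_mult compose_eq Q1_fst_closed Q1_snd_closed)
qed

section \<open>Actions, pairing and the solution axioms\<close>

lemma bimorphism_Q1_left_act: "bimorphism Q R R Q1_left_act"
  unfolding bimorphism_def Q1_left_act_eq
  using Q1_snd_hom sup_hom_Q1_snd by blast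

lemma bimorphism_Q1_right_act: "bimorphism L Q L Q1_right_act"
  unfolding bimorphism_def Q1_right_act_eq
  using Q1_fst_hom sup_hom_Q1_fst by blast

text \<open>Evaluating the two components in each of the two variables gives four maps. Two are
  actions with a fixed scalar or module element; in the other two the variable sits inside the
  pairing, so they are composites of a pairing with an action.\<close>

lemma bimorphism_Q1_pairing: "bimorphism R L Q pair_RL"
  unfolding bimorphism_def
proof (intro conjI ballI sup_hom_Q1I Q1_pairing_closed
    L.M.complete_lattice_axioms R.M.complete_lattice_axioms)
  fix r l assume r: "r \<in> carrier R" and l: "l \<in> carrier L"
  show "sup_hom L L (\<lambda>k. fst (pair_RL r k) l)"
    using bimorphism_right[OF TL bimorphism_closed[OF LR l r]] l by (simp add: Q1_pairing_def)
  show "sup_hom R R (\<lambda>s. snd (pair_RL s l) r)"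
    using bimorphism_left[OF RT bimorphism_closed[OF LR l r]] r by (simp add: Q1_pairing_def)
next
  fix r s assume r: "r \<in> carrier R" and s: "s \<in> carrier R"
  show "sup_hom L R (\<lambda>l. snd (pair_RL r l) s)"
    using sup_hom_comp[OF bimorphism_left[OF LR s] bimorphism_right[OF RT r]] s
    by (simp add: Q1_pairing_def)
next
  fix l k assume l: "l \<in> carrier L" and k: "k \<in> carrier L"
  show "sup_hom R L (\<lambda>r. fst (pair_RL r l) k)"
    using sup_hom_comp[OF bimorphism_right[OF LR k] bimorphism_left[OF TL l]] k
    by (simp add: Q1_pairing_def)
qed

lemma solution_Q1: "solution L T R act_TL act_RT pair_LR Q Q1_left_act Q1_right_act pair_RL"
proof -
  interpret Q: quantale Q
    by (rule quantale_Q1)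
  show ?thesis
  proof unfold_locales
    fix q r l assume asm: "q \<in> carrier Q" "r \<in> carrier R" "l \<in> carrier L"
    \<comment> \<open>The first components agree by compatibility of \<open>q\<close>, the second
      ones because \<open>snd q\<close> commutes with the action of \<open>T\<close>.\<close>
    show "pair_RL (Q1_left_act q r) l = q \<odot>\<^bsub>Q\<^esub> pair_RL r l"
      using asm by (intro Q1_eqI Q1_mult_closed Q1_pairing_closed) (auto simp: Q1_left_act_eq
          Q1_mult compose_eq Q1_pairing_def triad_closed Q1_carrierD)
  next
    fix r l q assume asm: "r \<in> carrier R" "l \<in> carrier L" "q \<in> carrier Q"
    \<comment> \<open>Here the first components agree because \<open>fst q\<close> commutes with the
      action of \<open>T\<close>, the second ones by compatibility.\<close>
    show "pair_RL r l \<odot>\<^bsub>Q\<^esub> q = pair_RL r (Q1_right_act l q)"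
      using asm by (intro Q1_eqI Q1_mult_closed Q1_pairing_closed) (auto simp: Q1_right_act_eq
          Q1_mult compose_eq Q1_pairing_def triad_closed Q1_carrierD)
  next
    fix r t l assume asm: "r \<in> carrier R" "t \<in> carrier T" "l \<in> carrier L"
    show "pair_RL (act_RT r t) l = pair_RL r (act_TL t l)"
      using asm by (intro Q1_eqI Q1_pairing_closed) (auto simp: triad_closed Q1_pairing_def
          pairing_left L.act_assoc R.act_assoc simp flip: pairing_right)
  \<comment> \<open>Among the remaining axioms, commutation of the actions is the module morphism
    property, (lq)r = l(qr) is compatibility, and (rl)r' = r(lr') and (lr)l' = l(rl') hold by
    definition of the pairing.\<close>
  qed (auto simp: bimorphism_Q1_left_act bimorphism_Q1_right_act bimorphism_Q1_pairing
      Q1_left_act_eq Q1_right_act_eq Q1_mult compose_eq Q1_pairing_def Q1_carrierD)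
qed

end

text \<open>The second conjunct records that the joins determined by the pointwise order are
  themselves computed pointwise.\<close>

theorem lemma3p5:
  fixes L :: "('l, 'x) gorder_scheme" and T :: "('t, 'y) quantale_scheme"
    and R :: "('r, 'z) gorder_scheme"
    and act_TL :: "'t \<Rightarrow> 'l \<Rightarrow> 'l" and act_RT :: "'r \<Rightarrow> 't \<Rightarrow> 'r" and pair_LR :: "'l \<Rightarrow> 'r \<Rightarrow> 't"
  assumes "triad L T R act_TL act_RT pair_LR"
  shows "solution L T R act_TL act_RT pair_LR
           (Q1 L T R act_TL act_RT pair_LR) Q1_left_act Q1_right_act (Q1_pairing L R act_TL act_RT pair_LR)
       \<and> (\<forall>A \<subseteq> carrier (Q1 L T R act_TL act_RT pair_LR).
            \<Squnion>\<^bsub>Q1 L T R act_TL act_RT pair_LR\<^esub> A =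
              (\<lambda>l\<in>carrier L. \<Squnion>\<^bsub>L\<^esub> ((\<lambda>(\<alpha>, \<beta>). \<alpha> l) ` A),
               \<lambda>r\<in>carrier R. \<Squnion>\<^bsub>R\<^esub> ((\<lambda>(\<alpha>, \<beta>). \<beta> r) ` A)))"
proof -
  interpret triad L T R act_TL act_RT pair_LR
    by fact
  show ?thesis
    by (simp add: solution_Q1 Q1_sup Q1_join_def case_prod_beta)
qed

end
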